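(* Let $p\geq 3$ be a prime and $n\geq 1$ be an integer. Then $\mathfrak{s}(\mathbb{F}_p^n)\leq 2p\cdot r(\mathbb{F}_p^n)$.
   Context: For a finite abelian group $G$ (written additively), $\exp(G)$ denotes its exponent, i.e. the least common multiple of the orders of all elements of $G$; in particular $\exp(\mathbb{F}_p^n)=p$. For a non-trivial finite abelian group $G$, the Erdős–Ginzburg–Ziv constant $\mathfrak{s}(G)$ is the smallest integer $s$ such that every sequence of $s$ (not necessarily distinct) elements of $G$ has a subsequence of length $\exp(G)$ whose elements sum to zero in $G$. A three-term arithmetic progression in $G$ is a set $\{x,y,z\}\subseteq G$ with $x,y,z$ distinct and $x+z=2y$. For a finite abelian group $G$, $r(G)$ denotes the largest size of a subset of $G$ that does not contain a three-term arithmetic progression. $\mathbb{F}_p^n$ is regarded as an additive group. *)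

theory Defs
  imports "HOL-Algebra.Product_Groups" "HOL-Number_Theory.Residues"
begin

text \<open>
  Abelian groups are structures of \<open>HOL-Algebra\<close>, whose operation is written multiplicatively:
  sums of group elements appear as products \<open>finprod G\<close>, and \<open>2y\<close> as \<open>y [^] 2\<close>.
\<close>

definition group_exponent :: "('a, 'b) monoid_scheme \<Rightarrow> nat" where
  "group_exponent G = Lcm (group.ord G ` carrier G)"

text \<open>
  A sequence is a list, and a subsequence is selected by a set of positions, so that repeated
  elements are used at most as often as they occur.
\<close>

definition has_zero_sum_subseq :: "('a, 'b) monoid_scheme \<Rightarrow> nat \<Rightarrow> 'a list \<Rightarrow> bool" where
  "has_zero_sum_subseq G m xs \<longleftrightarrow>
     (\<exists>I \<subseteq> {..<length xs}. card I = m \<and> finprod G (\<lambda>i. xs ! i) I = \<one>\<^bsub>G\<^esub>)"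

definition egz_property :: "('a, 'b) monoid_scheme \<Rightarrow> nat \<Rightarrow> bool" where
  "egz_property G s \<longleftrightarrow>
     (\<forall>xs. length xs = s \<and> set xs \<subseteq> carrier G \<longrightarrow> has_zero_sum_subseq G (group_exponent G) xs)"

text \<open>The minimum exists for every finite abelian group, by \<open>egz_property_ex\<close> below.\<close>

definition EGZ_constant :: "('a, 'b) monoid_scheme \<Rightarrow> nat" where
  "EGZ_constant G = (LEAST s. egz_property G s)"

definition three_term_AP :: "('a, 'b) monoid_scheme \<Rightarrow> 'a set \<Rightarrow> bool" where
  "three_term_AP G S \<longleftrightarrow>
     (\<exists>x\<in>carrier G. \<exists>y\<in>carrier G. \<exists>z\<in>carrier G.
        S = {x, y, z} \<and> x \<noteq> y \<and> y \<noteq> z \<and> x \<noteq> z \<and> x \<otimes>\<^bsub>G\<^esub> z = y [^]\<^bsub>G\<^esub> (2::nat))"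

definition max_AP_free :: "('a, 'b) monoid_scheme \<Rightarrow> nat" where
  "max_AP_free G = Max {card A |A. A \<subseteq> carrier G \<and> (\<nexists>S. S \<subseteq> A \<and> three_term_AP G S)}"

definition Fp_power :: "nat \<Rightarrow> nat \<Rightarrow> (nat \<Rightarrow> int) monoid" where
  "Fp_power p n = product_group {..<n} (\<lambda>_. add_monoid (residue_ring (int p)))"

lemma egz_property_ex:
  assumes "comm_group G" "finite (carrier G)"
  shows "\<exists>s. egz_property G s"
proof -
  interpret comm_group G by fact
  define m where "m = group_exponent G"
  have pow: "x [^]\<^bsub>G\<^esub> m = \<one>\<^bsub>G\<^esub>" if "x \<in> carrier G" for x
    unfolding m_def group_exponent_def using that pow_eq_id[OF that] by (simp add: dvd_Lcm)
  have "has_zero_sum_subseq G m xs"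
    if len: "length xs = Suc (card (carrier G) * m)" and sub: "set xs \<subseteq> carrier G" for xs
  proof -
    have "\<exists>y\<in>carrier G. m \<le> card {i\<in>{..<length xs}. xs ! i = y}"
    proof (rule ccontr)
      assume neg: "\<not> ?thesis"
      have "{..<length xs} = (\<Union>y\<in>carrier G. {i\<in>{..<length xs}. xs ! i = y})"
        using sub nth_mem by fastforce
      then have "length xs = card (\<Union>y\<in>carrier G. {i\<in>{..<length xs}. xs ! i = y})"
        by (metis card_lessThan)
      also have "\<dots> \<le> (\<Sum>y\<in>carrier G. card {i\<in>{..<length xs}. xs ! i = y})"
        by (rule card_UN_le) fact
      also have "\<dots> \<le> (\<Sum>y\<in>carrier G. m)"
        using neg by (intro sum_mono) (auto simp: not_le intro: less_imp_le)
      finally show False using len by simp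
    qed
    then obtain y where y: "y \<in> carrier G" and "m \<le> card {i\<in>{..<length xs}. xs ! i = y}"
      by blast
    then obtain I where I: "I \<subseteq> {i\<in>{..<length xs}. xs ! i = y}" "card I = m"
      by (meson obtain_subset_with_card_n)
    have "finprod G (\<lambda>i. xs ! i) I = finprod G (\<lambda>i. y) I"
      using I y by (intro finprod_cong') auto
    also have "\<dots> = \<one>\<^bsub>G\<^esub>"
      using finprod_const[OF y, of I] I pow[OF y] by simp
    finally show ?thesis
      unfolding has_zero_sum_subseq_def using I by blast
  qed
  then show ?thesis unfolding egz_property_def m_def by blast
qed

lemma comm_group_Fp_power:
  assumes "p > 1"
  shows "comm_group (Fp_power p n)"
proof -
  interpret residues "int p" "residue_ring (int p)"
    using assms by unfold_locales auto
  have "group (Fp_power p n)"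
    unfolding Fp_power_def by (intro product_group a_group)
  then show ?thesis
    by (rule group.group_comm_groupI)
      (auto simp: Fp_power_def residue_ring_def add.commute intro!: restrict_ext)
qed

lemma card_Fp_power: "card (carrier (Fp_power p n)) = p ^ n"
  by (simp add: Fp_power_def residue_ring_def card_PiE)

lemma group_exponent_Fp_power:
  assumes "prime p" "n \<ge> 1"
  shows "group_exponent (Fp_power p n) = p"
proof -
  have p1: "p > 1" using assms prime_gt_1_nat by blast
  interpret comm_group "Fp_power p n" by (rule comm_group_Fp_power) fact
  have pow_nth: "(x [^]\<^bsub>Fp_power p n\<^esub> (k::nat)) i = (int k * x i) mod int p"
    if "x \<in> carrier (Fp_power p n)" "i < n" for x k i
  proof (induction k)
    case 0
    then show ?case using that by (simp add: Fp_power_def residue_ring_def)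
  next
    case (Suc k)
    then show ?case using that
      by (simp add: Fp_power_def product_group_def residue_ring_def mod_add_left_eq mod_add_right_eq algebra_simps)
  qed
  have "group.ord (Fp_power p n) x dvd p" if x: "x \<in> carrier (Fp_power p n)" for x
  proof -
    have "x [^]\<^bsub>Fp_power p n\<^esub> p \<in> carrier (Fp_power p n)" using x by simp
    then have "x [^]\<^bsub>Fp_power p n\<^esub> p = \<one>\<^bsub>Fp_power p n\<^esub>"
      using pow_nth[OF x, of _ p]
      by (intro ext) (auto simp: Fp_power_def residue_ring_def PiE_iff extensional_def)
    then show ?thesis using pow_eq_id[OF x] by simp
  qed
  then have dvd: "group_exponent (Fp_power p n) dvd p"
    unfolding group_exponent_def by (auto intro: Lcm_least)
  define e :: "nat \<Rightarrow> int" where "e = (\<lambda>i\<in>{..<n}. 1)"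
  have e: "e \<in> carrier (Fp_power p n)"
    using p1 by (auto simp: e_def Fp_power_def residue_ring_def)
  have "e [^]\<^bsub>Fp_power p n\<^esub> (1::nat) \<noteq> \<one>\<^bsub>Fp_power p n\<^esub>"
  proof
    assume "e [^]\<^bsub>Fp_power p n\<^esub> (1::nat) = \<one>\<^bsub>Fp_power p n\<^esub>"
    from fun_cong[OF this, of 0] show False
      using pow_nth[OF e, of 0 1] assms(2) p1 by (simp add: e_def Fp_power_def residue_ring_def)
  qed
  then have "group.ord (Fp_power p n) e \<noteq> 1"
    using pow_eq_id[OF e, of 1] by auto
  moreover have "group.ord (Fp_power p n) e dvd group_exponent (Fp_power p n)"
    unfolding group_exponent_def using e by (simp add: dvd_Lcm)
  ultimately have "group_exponent (Fp_power p n) \<noteq> 1" by auto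
  then show ?thesis using dvd assms(1) prime_nat_iff by blast
qed

end

theory Submission
  imports Defs
begin

text \<open>
  Let \<open>m = 2k + 1\<close> be the exponent. If positions of a sequence can be collected into \<open>k\<close> disjoint
  pairs each summing to \<open>2y\<close>, where \<open>y\<close> stands at a further position, then these \<open>m\<close> positions sum
  to \<open>my = 0\<close>. Otherwise each position \<open>i\<close>, with entry \<open>y\<close>, has a set \<open>C i\<close> of fewer than \<open>m\<close> other
  positions that meets every pair summing to \<open>2y\<close> and contains all other occurrences of \<open>y\<close>.
  Read as a digraph with out-degrees at most \<open>m - 1\<close>, this has an independent set containing at
  least a fraction \<open>1/(2m - 1)\<close> of the positions, and the entries on an independent set are distinct
  and free of three-term progressions.
\<close>

text \<open>In-degrees within \<open>V\<close> sum to at most \<open>d * card V\<close>, so some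
  vertex \<open>v\<close> has in-degree at most \<open>d\<close>. Keep \<open>v\<close>, delete it
  with all its in- and out-neighbours, hence at most \<open>2 * d + 1\<close> vertices, and induct
  on the rest. The sets \<open>C v\<close> may leave \<open>V\<close>, which lets the induction pass
  to subsets of \<open>V\<close> with the same \<open>C\<close>.\<close>

lemma independent_set_bounded_outdegree:
  assumes "finite V" and "\<And>v. v \<in> V \<Longrightarrow> finite (C v) \<and> card (C v) \<le> d"
  shows "\<exists>I\<subseteq>V. card V \<le> card I * (2 * d + 1) \<and> (\<forall>u\<in>I. \<forall>v\<in>I. u \<noteq> v \<longrightarrow> v \<notin> C u)"
  using assms
proof (induction "card V" arbitrary: V rule: less_induct)
  case less
  show ?case
  proof (cases "V = {}")
    case False
    define N where "N v = {u\<in>V. v \<in> C u}" for v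
    \<comment> \<open>Double counting of the edges inside \<open>V\<close>, by head and by
      tail.\<close>
    have "(\<Sum>v\<in>V. card (N v)) = (\<Sum>u\<in>V. card (C u \<inter> V))"
    proof -
      have "(\<Sum>v\<in>V. card (N v)) = (\<Sum>v\<in>V. \<Sum>u\<in>V. if v \<in> C u then 1 else 0)"
        unfolding N_def using less.prems(1)
        by (intro sum.cong) (auto simp: sum.If_cases Int_def)
      also have "\<dots> = (\<Sum>u\<in>V. \<Sum>v\<in>V. if v \<in> C u then 1 else 0)"
        by (rule sum.swap)
      also have "\<dots> = (\<Sum>u\<in>V. card (C u \<inter> V))"
        using less.prems(1) by (intro sum.cong) (auto simp: sum.If_cases Int_commute)
      finally show ?thesis .
    qed
    also have "\<dots> \<le> (\<Sum>u\<in>V. d)"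
      using less.prems(2) by (intro sum_mono) (meson card_mono inf_le1 order_trans)
    finally have sum_le: "(\<Sum>v\<in>V. card (N v)) \<le> card V * d" by simp
    have "\<exists>v\<in>V. card (N v) \<le> d"
    proof (rule ccontr)
      assume "\<not> ?thesis"
      then have "(\<Sum>v\<in>V. d) < (\<Sum>v\<in>V. card (N v))"
        using False less.prems(1) by (intro sum_strict_mono) auto
      then show False using sum_le by simp
    qed
    then obtain v where v: "v \<in> V" "card (N v) \<le> d" by blast
    define D where "D = insert v (N v \<union> C v)"
    have finD: "finite D"
      unfolding D_def N_def using less.prems v by auto
    have cD: "card D \<le> 2 * d + 1"
    proof -
      have "card D \<le> Suc (card (N v \<union> C v))"
        unfolding D_def by (rule card_insert_le_m1[of "Suc _", simplified]) auto
      then show ?thesis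
        using card_Un_le[of "N v" "C v"] v less.prems(2)[OF v(1)] by linarith
    qed
    have "card (V - D) < card V"
      using v less.prems(1) by (intro psubset_card_mono) (auto simp: D_def)
    then obtain I where I: "I \<subseteq> V - D" "card (V - D) \<le> card I * (2 * d + 1)"
      "\<forall>u\<in>I. \<forall>w\<in>I. u \<noteq> w \<longrightarrow> w \<notin> C u"
      using less.hyps[of "V - D"] less.prems by (metis Diff_iff finite_Diff)
    have "finite I" "v \<notin> I"
      using I(1) less.prems(1) by (auto simp: D_def intro: finite_subset)
    moreover have "card V \<le> card (V - D) + card D"
      using finD by (simp add: diff_card_le_card_Diff le_diff_conv[symmetric])
    ultimately have "card V \<le> card (insert v I) * (2 * d + 1)"
      using I(2) cD by simp
    \<comment> \<open>Since \<open>I\<close> avoids both \<open>N v\<close> and \<open>C v\<close>,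
      no edge joins \<open>v\<close> to \<open>I\<close> in either direction.\<close>
    moreover have "\<forall>u\<in>insert v I. \<forall>w\<in>insert v I. u \<noteq> w \<longrightarrow> w \<notin> C u"
      using I(1,3) by (auto simp: D_def N_def)
    ultimately show ?thesis
      using I(1) v(1) by (intro exI[of _ "insert v I"]) auto
  qed simp
qed

text \<open>Greedy choice: take as \<open>C\<close> a largest set that looks like a union of
  disjoint pairs, each with sum \<open>2y\<close>. A further such pair outside \<open>C\<close>
  would either enlarge \<open>C\<close> or complete a set of size \<open>2 * k\<close> excluded by
  \<open>none\<close>.\<close>

lemma (in comm_group) small_set_meeting_pairs:
  assumes V: "finite V" and f: "f \<in> V \<rightarrow> carrier G" and y: "y \<in> carrier G"
    and none: "\<And>C. C \<subseteq> V \<Longrightarrow> card C = 2 * k \<Longrightarrow> finprod G f C \<noteq> y [^] (2 * k)"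
  shows "\<exists>C\<subseteq>V. card C < 2 * k \<and>
    (\<forall>a\<in>V - C. \<forall>b\<in>V - C. a \<noteq> b \<longrightarrow> f a \<otimes> f b \<noteq> y [^] (2::nat))"
proof -
  \<comment> \<open>The pairing itself is forgotten: an even size and the right total suffice for
    the extension argument.\<close>
  define P where
    "P C \<longleftrightarrow> C \<subseteq> V \<and> even (card C) \<and> card C < 2 * k \<and> finprod G f C = y [^] card C" for C
  \<comment> \<open>For \<open>k = 0\<close> the empty set would violate \<open>none\<close>; a
    positive \<open>k\<close> gives the search for a maximal \<open>C\<close> its starting
    point.\<close>
  have "k \<noteq> 0" using none[of "{}"] by auto
  then have "P {}" by (simp add: P_def)
  then obtain C where C: "P C" and max: "\<And>D. P D \<Longrightarrow> card D \<le> card C"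
    using ex_has_greatest_nat[of P "{}" card "2 * k"] unfolding P_def
    by (metis less_imp_le)
  have "f a \<otimes> f b \<noteq> y [^] (2::nat)" if ab: "a \<in> V - C" "b \<in> V - C" "a \<noteq> b" for a b
  proof
    assume eq: "f a \<otimes> f b = y [^] (2::nat)"
    define D where "D = insert a (insert b C)"
    have fC: "finite C" "f \<in> C \<rightarrow> carrier G"
      using C V f by (auto simp: P_def intro: finite_subset)
    have cD: "card D = card C + 2"
      unfolding D_def using ab fC by simp
    have "finprod G f D = (f a \<otimes> f b) \<otimes> finprod G f C"
      unfolding D_def using ab fC f by (simp add: finprod_insert Pi_iff m_assoc)
    also have "\<dots> = y [^] card D"
      using C y by (simp add: eq cD P_def nat_pow_mult add.commute)
    finally have prod: "finprod G f D = y [^] card D" .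
    have "D \<subseteq> V" using C ab by (auto simp: D_def P_def)
    show False
    proof (cases "card D = 2 * k")
      case True
      then show False using none[OF \<open>D \<subseteq> V\<close>] prod by simp
    next
      case False
      \<comment> \<open>By parity, two more positions cannot jump over \<open>2 * k\<close>.\<close>
      have "even (card C)" "card C < 2 * k" using C by (simp_all add: P_def)
      then have "card D < 2 * k" using False cD by presburger
      then have "P D" using C prod cD \<open>D \<subseteq> V\<close> by (simp add: P_def)
      then show False using max cD by fastforce
    qed
  qed
  then show ?thesis using C unfolding P_def by blast
qed

lemma (in comm_group) card_le_max_AP_free:
  assumes "finite (carrier G)" and "A \<subseteq> carrier G" and "\<nexists>S. S \<subseteq> A \<and> three_term_AP G S"
  shows "card A \<le> max_AP_free G"
  unfolding max_AP_free_def
proof (rule Max_ge)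
  have "{card A |A. A \<subseteq> carrier G \<and> (\<nexists>S. S \<subseteq> A \<and> three_term_AP G S)} \<subseteq> card ` Pow (carrier G)"
    by auto
  then show "finite {card A |A. A \<subseteq> carrier G \<and> (\<nexists>S. S \<subseteq> A \<and> three_term_AP G S)}"
    by (rule finite_subset) (simp add: assms(1))
qed (use assms in blast)

text \<open>A singleton contains no progression. Positivity is what later makes
  \<open>r * (2 * m - 1) < 2 * m * r\<close> strict.\<close>

lemma (in comm_group) max_AP_free_pos:
  assumes "finite (carrier G)"
  shows "max_AP_free G > 0"
proof -
  have "card {\<one>} \<le> max_AP_free G"
    using assms by (rule card_le_max_AP_free) (auto simp: three_term_AP_def)
  then show ?thesis by simp
qed

lemma (in comm_group) pow_group_exponent:
  assumes "x \<in> carrier G"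
  shows "x [^] group_exponent G = \<one>"
  unfolding group_exponent_def using assms pow_eq_id[OF assms] by (simp add: dvd_Lcm)

text \<open>With exponent \<open>2 * k + 1\<close>, any \<open>2 * k\<close> positions other than
  \<open>i\<close> with sum \<open>2ky\<close> would form, together with \<open>i\<close>, a
  zero-sum subsequence. So \<open>small_set_meeting_pairs\<close> applies to the positions other
  than \<open>i\<close>; the set it gives is then enlarged to catch every repetition of the entry at
  \<open>i\<close>.\<close>

lemma (in comm_group) few_positions_meeting_APs:
  assumes odd: "odd (group_exponent G)" and xs: "set xs \<subseteq> carrier G"
    and nz: "\<not> has_zero_sum_subseq G (group_exponent G) xs" and i: "i < length xs"
  shows "\<exists>C. finite C \<and> card C \<le> group_exponent G - 1 \<and>
    (\<forall>j<length xs. j \<noteq> i \<and> xs ! j = xs ! i \<longrightarrow> j \<in> C) \<and>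
    (\<forall>a<length xs. \<forall>b<length xs. a \<noteq> i \<and> b \<noteq> i \<and> a \<noteq> b \<and>
       xs ! a \<otimes> xs ! b = (xs ! i) [^] (2::nat) \<longrightarrow> a \<in> C \<or> b \<in> C)"
proof -
  define m where "m = group_exponent G"
  obtain k where k: "m = 2 * k + 1" using odd unfolding m_def by (elim oddE)
  define V where "V = {..<length xs} - {i}"
  define y where "y = xs ! i"
  have y: "y \<in> carrier G" using xs i by (auto simp: y_def)
  have V: "finite V" "i \<notin> V" "insert i V = {..<length xs}" using i by (auto simp: V_def)
  have f: "(!) xs \<in> V \<rightarrow> carrier G"
    using xs nth_mem by (fastforce simp: V_def)
  have none: "finprod G ((!) xs) C \<noteq> y [^] (2 * k)" if C: "C \<subseteq> V" "card C = 2 * k" for C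
  proof
    assume eq: "finprod G ((!) xs) C = y [^] (2 * k)"
    have C': "finite C" "i \<notin> C" using C V by (auto intro: finite_subset)
    have "finprod G ((!) xs) (insert i C) = y \<otimes> y [^] (2 * k)"
      using C' C(1) f y eq by (subst finprod_insert) (auto simp: y_def)
    also have "\<dots> = y [^] m"
      using y by (simp add: k nat_pow_Suc m_comm)
    also have "\<dots> = \<one>"
      unfolding m_def by (rule pow_group_exponent) fact
    finally have "finprod G ((!) xs) (insert i C) = \<one>" .
    moreover have "card (insert i C) = m" using C' C k by simp
    moreover have "insert i C \<subseteq> {..<length xs}" using C V by blast
    ultimately show False
      using nz unfolding has_zero_sum_subseq_def m_def by blast
  qed
  have "\<exists>C\<subseteq>V. card C < 2 * k \<and>
      (\<forall>a\<in>V - C. \<forall>b\<in>V - C. a \<noteq> b \<longrightarrow> xs ! a \<otimes> xs ! b \<noteq> y [^] (2::nat))"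
    by (intro small_set_meeting_pairs V(1) f y none)
  then obtain C where C: "C \<subseteq> V" "card C < 2 * k" and pairs: "\<forall>a\<in>V - C. \<forall>b\<in>V - C. a \<noteq> b \<longrightarrow> xs ! a \<otimes> xs ! b \<noteq> y [^] (2::nat)"
    by blast
  define E where "E = {j \<in> V - C. xs ! j = y}"
  text \<open>Two occurrences of \<open>y\<close> outside \<open>C\<close> would themselves form a pair with sum \<open>2y\<close>.\<close>
  have "card E \<le> Suc 0"
  proof (subst card_le_Suc0_iff_eq)
    have "y \<otimes> y = y [^] (2::nat)" using y by (simp add: numeral_2_eq_2)
    then show "\<forall>a\<in>E. \<forall>b\<in>E. a = b"
      using pairs by (fastforce simp: E_def)
  qed (use V(1) in \<open>simp add: E_def\<close>)
  \<comment> \<open>The strict bound \<open>card C < 2 * k\<close> leaves room for the at most one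
    element of \<open>E\<close>.\<close>
  then have "card (C \<union> E) \<le> m - 1"
    using card_Un_le[of C E] C k by linarith
  moreover have "finite (C \<union> E)"
    using C V by (auto simp: E_def intro: finite_subset)
  moreover have "\<forall>j<length xs. j \<noteq> i \<and> xs ! j = xs ! i \<longrightarrow> j \<in> C \<union> E"
    by (auto simp: E_def V_def y_def)
  moreover have "\<forall>a<length xs. \<forall>b<length xs. a \<noteq> i \<and> b \<noteq> i \<and> a \<noteq> b \<and>
       xs ! a \<otimes> xs ! b = (xs ! i) [^] (2::nat) \<longrightarrow> a \<in> C \<union> E \<or> b \<in> C \<union> E"
    using pairs by (auto simp: V_def y_def)
  ultimately show ?thesis unfolding m_def by blast
qed

text \<open>A counterexample of length \<open>2 * m * r\<close> would yield an independent set of at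
  least \<open>2 * m * r / (2 * m - 1)\<close> positions. This exceeds \<open>r\<close>, although
  the entries there are distinct and contain no progression.\<close>

lemma (in comm_group) egz_property_odd_exponent:
  assumes fin: "finite (carrier G)" and odd: "odd (group_exponent G)"
  shows "egz_property G (2 * group_exponent G * max_AP_free G)"
proof -
  define m where "m = group_exponent G"
  define r where "r = max_AP_free G"
  have "m > 0" using odd by (auto simp: m_def intro: Nat.gr0I)
  have False if len: "length xs = 2 * m * r" and xs: "set xs \<subseteq> carrier G"
    and nz: "\<not> has_zero_sum_subseq G m xs" for xs
  proof -
    have "\<forall>i\<in>{..<length xs}. \<exists>C. finite C \<and> card C \<le> m - 1 \<and>
        (\<forall>j<length xs. j \<noteq> i \<and> xs ! j = xs ! i \<longrightarrow> j \<in> C) \<and>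
        (\<forall>a<length xs. \<forall>b<length xs. a \<noteq> i \<and> b \<noteq> i \<and> a \<noteq> b \<and>
           xs ! a \<otimes> xs ! b = (xs ! i) [^] (2::nat) \<longrightarrow> a \<in> C \<or> b \<in> C)"
      using few_positions_meeting_APs[OF odd xs nz[unfolded m_def]] unfolding m_def
      by (intro ballI) simp
    from bchoice[OF this] obtain C where C: "\<forall>i\<in>{..<length xs}. finite (C i) \<and> card (C i) \<le> m - 1 \<and>
        (\<forall>j<length xs. j \<noteq> i \<and> xs ! j = xs ! i \<longrightarrow> j \<in> C i) \<and>
        (\<forall>a<length xs. \<forall>b<length xs. a \<noteq> i \<and> b \<noteq> i \<and> a \<noteq> b \<and>
           xs ! a \<otimes> xs ! b = (xs ! i) [^] (2::nat) \<longrightarrow> a \<in> C i \<or> b \<in> C i)"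
      by (rule exE)
    have same: "j \<in> C i"
      if "i < length xs" "j < length xs" "j \<noteq> i" "xs ! j = xs ! i" for i j
      using bspec[OF C, of i] that by simp
    have pair: "a \<in> C i \<or> b \<in> C i"
      if "i < length xs" "a < length xs" "b < length xs" "a \<noteq> i" "b \<noteq> i" "a \<noteq> b"
        "xs ! a \<otimes> xs ! b = (xs ! i) [^] (2::nat)" for i a b
      using bspec[OF C, of i] that by simp
    obtain I where I: "I \<subseteq> {..<length xs}" "length xs \<le> card I * (2 * (m - 1) + 1)"
      and indep: "\<And>i j. i \<in> I \<Longrightarrow> j \<in> I \<Longrightarrow> i \<noteq> j \<Longrightarrow> j \<notin> C i"
    proof -
      have "finite (C i) \<and> card (C i) \<le> m - 1" if "i \<in> {..<length xs}" for i
        using bspec[OF C that] by blast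
      then show thesis
        using independent_set_bounded_outdegree[of "{..<length xs}" C "m - 1"] that
        by (metis card_lessThan finite_lessThan)
    qed
    have "inj_on ((!) xs) I"
      using same indep I(1) by (intro inj_onI) (metis lessThan_iff subsetD)
    then have "card I = card ((!) xs ` I)" by (simp add: card_image)
    also have "\<dots> \<le> r"
      unfolding r_def
    proof (rule card_le_max_AP_free[OF fin])
      show "(!) xs ` I \<subseteq> carrier G" using I(1) xs by (auto dest!: subsetD)
      show "\<nexists>S. S \<subseteq> (!) xs ` I \<and> three_term_AP G S"
      proof
        assume "\<exists>S. S \<subseteq> (!) xs ` I \<and> three_term_AP G S"
        then obtain a i b where "a \<in> I" "i \<in> I" "b \<in> I" and
          "xs ! a \<noteq> xs ! i" "xs ! i \<noteq> xs ! b" "xs ! a \<noteq> xs ! b"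
          "xs ! a \<otimes> xs ! b = (xs ! i) [^] (2::nat)"
          unfolding three_term_AP_def by (auto simp: image_iff)
        \<comment> \<open>The middle term of the progression stands at position \<open>i\<close>, so
          \<open>pair\<close> puts \<open>a\<close> or \<open>b\<close> into \<open>C i\<close>,
          against independence.\<close>
        then show False
          using pair[of i a b] indep[of i a] indep[of i b] I(1) by blast
      qed
    qed
    finally have "card I \<le> r" .
    from order_trans[OF I(2) mult_le_mono1[OF this]]
    have "2 * m * r \<le> r * (2 * (m - 1) + 1)"
      unfolding len .
    moreover have "2 * (m - 1) + 1 < 2 * m" using \<open>m > 0\<close> by simp
    moreover have "r > 0" unfolding r_def using fin by (rule max_AP_free_pos)
    ultimately show False
      by (metis leD mult.commute mult_less_cancel1)
  qed
  then show ?thesis unfolding egz_property_def m_def r_def by blast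
qed

theorem theorem4:
  fixes p n :: nat
  assumes "prime p" and "p \<ge> 3" and "n \<ge> 1"
  shows "EGZ_constant (Fp_power p n) \<le> 2 * p * max_AP_free (Fp_power p n)"
proof -
  interpret comm_group "Fp_power p n"
    using assms by (intro comm_group_Fp_power) simp
  have "finite (carrier (Fp_power p n))"
    using assms by (intro card_ge_0_finite) (simp add: card_Fp_power)
  moreover have exponent: "group_exponent (Fp_power p n) = p"
    using assms by (intro group_exponent_Fp_power)
  \<comment> \<open>Here \<open>p \<ge> 3\<close> excludes the even prime.\<close>
  moreover have "odd p"
    using assms by (intro prime_odd_nat) auto
  ultimately have "egz_property (Fp_power p n) (2 * p * max_AP_free (Fp_power p n))"
    using egz_property_odd_exponent by simp
  then show ?thesis unfolding EGZ_constant_def by (rule Least_le)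
qed

end
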